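(* Let $T$ be a locally finite tree and let $H$ be a closed subgroup of $\mathrm{Aut}(T)$. Suppose that $H$ is unimodular and acts cocompactly on $T$. Fix a vertex $v_0\in V(T)$. Then for each integer $k\geq 0$, the set $$\{J\in\mathbf{Sub}(\mathrm{Aut}(T)) \mid \sigma J\sigma^{-1}\leq\overline{H}^{k}\text{ for some }\sigma\in\mathrm{Aut}(T)_{v_0}^{[k]}\}$$ is a neighborhood of $H$ in $\mathbf{Sub}(\mathrm{Aut}(T))$.
   Context: $\mathrm{Aut}(T)$ carries the topology of pointwise convergence on vertices; it is a second countable totally disconnected locally compact group. $\mathbf{Sub}(\mathrm{Aut}(T))$ is the space of closed subgroups of $\mathrm{Aut}(T)$ with the Chabauty topology: a base of neighborhoods of $H$ is given by the sets $\{J \mid J\cap K\subseteq HU,\ H\cap K\subseteq JU\}$ with $K$ compact and $U$ an open identity neighborhood. A group acts cocompactly on $T$ if it has finitely many orbits of vertices. $B(v,k)$ is the ball of radius $k$ around $v$ in $T$. For $J\leq\mathrm{Aut}(T)$, the $k$-closure of $J$ is $\overline{J}^{k}:=\{g\in\mathrm{Aut}(T) \mid \forall v\in V(T),\ \exists h\in J:\ g|_{B(v,k)}=h|_{B(v,k)}\}$. $\mathrm{Aut}(T)_{v_0}^{[k]}$ is the pointwise stabilizer of $B(v_0,k)$ in $\mathrm{Aut}(T)$. *)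

theory Defs
  imports
    "HOL-Analysis.Analysis"
    "HOL-Algebra.Group_Action"
    "Graph_Theory.Pair_Digraph"
    "Graph_Theory.Digraph_Component"
begin

section \<open>Trees and their automorphism groups\<close>

text \<open>
  An undirected simple graph is a loop-free symmetric pair digraph, not necessarily finite.
  The predicate \<^const>\<open>tree\<close> is not usable here: in a symmetric digraph it
  counts every pair of opposite arcs as a cycle of length two. Undirected cycles are the
  directed cycles of length at least three.
\<close>

definition undirected_tree :: "'v pair_pre_digraph \<Rightarrow> bool" where
  "undirected_tree T \<longleftrightarrow>
     pair_bidirected_digraph T \<and> strongly_connected (with_proj T) \<and>
     \<not> (\<exists>p. pre_digraph.cycle (with_proj T) p \<and> 3 \<le> length p)"

definition locally_finite_graph :: "'v pair_pre_digraph \<Rightarrow> bool" where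
  "locally_finite_graph T \<longleftrightarrow> (\<forall>v \<in> pverts T. finite (out_arcs (with_proj T) v))"

definition graph_ball :: "'v pair_pre_digraph \<Rightarrow> 'v \<Rightarrow> nat \<Rightarrow> 'v set" where
  "graph_ball T v k = {w. \<exists>p. pre_digraph.awalk (with_proj T) v p w \<and> length p \<le> k}"

text \<open>
  As in \<^const>\<open>BijGroup\<close>, automorphisms are extensional functions: they are
  \<^const>\<open>undefined\<close> outside the vertex set.
\<close>

definition graph_auts :: "'v pair_pre_digraph \<Rightarrow> ('v \<Rightarrow> 'v) set" where
  "graph_auts T = {f \<in> Bij (pverts T).
     \<forall>u \<in> pverts T. \<forall>v \<in> pverts T. (f u, f v) \<in> parcs T \<longleftrightarrow> (u, v) \<in> parcs T}"

definition Aut :: "'v pair_pre_digraph \<Rightarrow> ('v \<Rightarrow> 'v) monoid" where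
  "Aut T = BijGroup (pverts T) \<lparr>carrier := graph_auts T\<rparr>"

definition Aut_top :: "'v pair_pre_digraph \<Rightarrow> ('v \<Rightarrow> 'v) topology" where
  "Aut_top T =
     subtopology (product_topology (\<lambda>_. discrete_topology (pverts T)) (pverts T)) (graph_auts T)"

definition k_closure :: "'v pair_pre_digraph \<Rightarrow> nat \<Rightarrow> ('v \<Rightarrow> 'v) set \<Rightarrow> ('v \<Rightarrow> 'v) set" where
  "k_closure T k J = {g \<in> carrier (Aut T).
     \<forall>v \<in> pverts T. \<exists>h \<in> J. \<forall>w \<in> graph_ball T v k. g w = h w}"

definition ball_fixator :: "'v pair_pre_digraph \<Rightarrow> 'v \<Rightarrow> nat \<Rightarrow> ('v \<Rightarrow> 'v) set" where
  "ball_fixator T v k = {g \<in> carrier (Aut T). \<forall>w \<in> graph_ball T v k. g w = w}"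

definition acts_cocompactly :: "'v pair_pre_digraph \<Rightarrow> ('v \<Rightarrow> 'v) set \<Rightarrow> bool" where
  "acts_cocompactly T H \<longleftrightarrow> finite (orbits (Aut T \<lparr>carrier := H\<rparr>) (pverts T) (\<lambda>g. g))"


section \<open>Haar measures and unimodularity\<close>

text \<open>
  Below, a topological group is given by a group \<open>G\<close> and a topology \<open>X\<close> whose
  underlying set is the carrier of \<open>G\<close>.
\<close>

definition radon_measure :: "'a topology \<Rightarrow> 'a measure \<Rightarrow> bool" where
  "radon_measure X \<mu> \<longleftrightarrow>
     space \<mu> = topspace X \<and>
     sets \<mu> = sigma_sets (topspace X) {U. openin X U} \<and>
     (\<forall>K. compactin X K \<longrightarrow> emeasure \<mu> K < \<infinity>) \<and>
     (\<forall>B \<in> sets \<mu>. emeasure \<mu> B = (INF U \<in> {U. openin X U \<and> B \<subseteq> U}. emeasure \<mu> U)) \<and>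
     (\<forall>U. openin X U \<longrightarrow>
        emeasure \<mu> U = (SUP K \<in> {K. compactin X K \<and> K \<subseteq> U}. emeasure \<mu> K))"

definition left_haar_measure :: "('a, 'b) monoid_scheme \<Rightarrow> 'a topology \<Rightarrow> 'a measure \<Rightarrow> bool" where
  "left_haar_measure G X \<mu> \<longleftrightarrow>
     radon_measure X \<mu> \<and> emeasure \<mu> (space \<mu>) \<noteq> 0 \<and>
     (\<forall>g \<in> carrier G. \<forall>B \<in> sets \<mu>. emeasure \<mu> (g <#\<^bsub>G\<^esub> B) = emeasure \<mu> B)"

text \<open>
  On a locally compact group left Haar measures exist and are unique up to scaling, so it does
  not matter whether one asks for right invariance of some or of every left Haar measure.
\<close>

definition unimodular :: "('a, 'b) monoid_scheme \<Rightarrow> 'a topology \<Rightarrow> bool" where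
  "unimodular G X \<longleftrightarrow>
     (\<exists>\<mu>. left_haar_measure G X \<mu> \<and>
        (\<forall>g \<in> carrier G. \<forall>B \<in> sets \<mu>. emeasure \<mu> (B #>\<^bsub>G\<^esub> g) = emeasure \<mu> B))"


section \<open>The Chabauty topology\<close>

definition closed_subgroups :: "('a, 'b) monoid_scheme \<Rightarrow> 'a topology \<Rightarrow> 'a set set" where
  "closed_subgroups G X = {H. subgroup H G \<and> closedin X H}"

definition chabauty_nbhd ::
  "('a, 'b) monoid_scheme \<Rightarrow> 'a topology \<Rightarrow> 'a set \<Rightarrow> 'a set \<Rightarrow> 'a set \<Rightarrow> 'a set set" where
  "chabauty_nbhd G X H K U =
     {J \<in> closed_subgroups G X. J \<inter> K \<subseteq> H <#>\<^bsub>G\<^esub> U \<and> H \<inter> K \<subseteq> J <#>\<^bsub>G\<^esub> U}"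

text \<open>
  The topology with the sets \<^const>\<open>chabauty_nbhd\<close> as bases of neighbourhoods: a set is open
  iff it contains a basic neighbourhood of each of its points. The basic neighbourhoods
  themselves need not be open.
\<close>

definition chabauty_open ::
  "('a, 'b) monoid_scheme \<Rightarrow> 'a topology \<Rightarrow> 'a set set \<Rightarrow> bool" where
  "chabauty_open G X W \<longleftrightarrow>
     W \<subseteq> closed_subgroups G X \<and>
     (\<forall>H \<in> W. \<exists>K U. compactin X K \<and> openin X U \<and> \<one>\<^bsub>G\<^esub> \<in> U \<and> chabauty_nbhd G X H K U \<subseteq> W)"

definition chabauty :: "('a, 'b) monoid_scheme \<Rightarrow> 'a topology \<Rightarrow> 'a set topology" where
  "chabauty G X = topology (chabauty_open G X)"

lemma chabauty_nbhd_mono: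
  assumes "K \<subseteq> K'" "U' \<subseteq> U"
  shows "chabauty_nbhd G X H K' U' \<subseteq> chabauty_nbhd G X H K U"
  using assms unfolding chabauty_nbhd_def set_mult_def by blast

lemma istopology_chabauty_open: "istopology (chabauty_open G X)"
  unfolding istopology_def
proof (intro conjI allI impI)
  fix V W assume V: "chabauty_open G X V" and W: "chabauty_open G X W"
  show "chabauty_open G X (V \<inter> W)"
    unfolding chabauty_open_def
  proof (intro conjI ballI)
    show "V \<inter> W \<subseteq> closed_subgroups G X"
      using V by (auto simp: chabauty_open_def)
    fix H assume H: "H \<in> V \<inter> W"
    obtain K U where 1: "compactin X K" "openin X U" "\<one>\<^bsub>G\<^esub> \<in> U" "chabauty_nbhd G X H K U \<subseteq> V"
      using V H unfolding chabauty_open_def by blast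
    obtain K' U' where 2: "compactin X K'" "openin X U'" "\<one>\<^bsub>G\<^esub> \<in> U'" "chabauty_nbhd G X H K' U' \<subseteq> W"
      using W H unfolding chabauty_open_def by blast
    have "chabauty_nbhd G X H (K \<union> K') (U \<inter> U') \<subseteq> V \<inter> W"
      using chabauty_nbhd_mono[of K "K \<union> K'" "U \<inter> U'" U G X H]
        chabauty_nbhd_mono[of K' "K \<union> K'" "U \<inter> U'" U' G X H] 1(4) 2(4) by blast
    with 1 2 show "\<exists>K U. compactin X K \<and> openin X U \<and> \<one>\<^bsub>G\<^esub> \<in> U \<and> chabauty_nbhd G X H K U \<subseteq> V \<inter> W"
      by (intro exI[of _ "K \<union> K'"] exI[of _ "U \<inter> U'"]) (auto intro: compactin_Un)
  qed
next
  fix \<W> assume *: "\<forall>W \<in> \<W>. chabauty_open G X W"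
  show "chabauty_open G X (\<Union>\<W>)"
    unfolding chabauty_open_def
  proof (intro conjI ballI)
    show "\<Union>\<W> \<subseteq> closed_subgroups G X"
      using * by (auto simp: chabauty_open_def)
    fix H assume "H \<in> \<Union>\<W>"
    then obtain W where W: "W \<in> \<W>" "H \<in> W" by blast
    with * obtain K U where "compactin X K" "openin X U" "\<one>\<^bsub>G\<^esub> \<in> U" "chabauty_nbhd G X H K U \<subseteq> W"
      unfolding chabauty_open_def by metis
    with W show "\<exists>K U. compactin X K \<and> openin X U \<and> \<one>\<^bsub>G\<^esub> \<in> U \<and> chabauty_nbhd G X H K U \<subseteq> \<Union>\<W>"
      by blast
  qed
qed

lemma openin_chabauty: "openin (chabauty G X) W \<longleftrightarrow> chabauty_open G X W"
  by (simp add: chabauty_def topology_inverse' istopology_chabauty_open)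

end

theory Submission
  imports Defs
begin

text \<open>
  Let \<open>B(v0, R)\<close> meet every \<open>H\<close>-orbit. If \<open>J\<close> is close to \<open>H\<close>, then elements of \<open>J\<close> with small
  displacement of \<open>v0\<close> agree with elements of \<open>H\<close> on a large ball around \<open>v0\<close> and conversely, so
  the translates of \<open>B(v0, R)\<close> under \<open>J\<close> cover \<open>T\<close> as well. Call an automorphism \<open>h j\<close> with
  \<open>h \<in> H\<close>, \<open>j \<in> J\<close> admissible at \<open>v\<close> if \<open>j v \<in> B(v0, R)\<close>. An automorphism admissible at \<open>v\<close>
  agrees on \<open>B(w, k)\<close> with one admissible at the neighbour \<open>w\<close>: bring \<open>j w\<close> back into \<open>B(v0, R)\<close> by
  some \<open>j1 \<in> J\<close> and undo this on the left by an element of \<open>H\<close> close to \<open>j1\<close>. Propagating the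
  identity from \<open>v0\<close> along the tree and gluing gives the automorphism \<open>\<sigma>\<close>, and \<open>\<sigma> J \<sigma>\<^sup>-\<^sup>1\<close> agrees with
  \<open>H\<close> on every \<open>k\<close>-ball because admissible maps differ from elements of \<open>J\<close> near \<open>v0\<close> only by
  elements of \<open>H\<close>.
\<close>

section \<open>Balls and geodesic levels in a tree\<close>

locale lf_tree =
  fixes T :: "'v pair_pre_digraph"
  assumes tree: "undirected_tree T" and locally_finite: "locally_finite_graph T"

sublocale lf_tree \<subseteq> pair_bidirected_digraph T
  using tree unfolding undirected_tree_def by blast

context lf_tree
begin

abbreviation "V \<equiv> pverts T"
abbreviation "E \<equiv> parcs T"
abbreviation "gball \<equiv> graph_ball T"

lemma arc_sym: "(u, v) \<in> E \<Longrightarrow> (v, u) \<in> E"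
  using pair_sym_arcs unfolding symmetric_def by (auto elim: symE)

lemma connected: "u \<in> V \<Longrightarrow> v \<in> V \<Longrightarrow> \<exists>p. awalk u p v"
  using tree unfolding undirected_tree_def strongly_connected_def
  by (simp add: reachable_awalk)

lemma ball_subset: "gball v k \<subseteq> V"
  unfolding graph_ball_def by (auto dest: awalk_last_in_verts)

lemma ball_0: "v \<in> V \<Longrightarrow> gball v 0 = {v}"
  unfolding graph_ball_def by (auto simp: awalk_Nil_iff)

lemma ball_center: "v \<in> V \<Longrightarrow> v \<in> gball v k"
  unfolding graph_ball_def by (auto simp: awalk_Nil_iff intro!: exI[of _ "[]"])

lemma ball_mono: "i \<le> k \<Longrightarrow> gball v i \<subseteq> gball v k"
  unfolding graph_ball_def by (auto intro: order_trans)

lemma ball_trans: "w \<in> gball v i \<Longrightarrow> x \<in> gball w j \<Longrightarrow> x \<in> gball v (i + j)"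
  unfolding graph_ball_def
  by clarsimp (metis add_mono awalk_appendI length_append)

lemma ball_arc: "(v, w) \<in> E \<Longrightarrow> w \<in> gball v (Suc 0)"
  unfolding graph_ball_def
  by (auto intro!: exI[of _ "[(v, w)]"] simp: awalk_Cons_iff awalk_Nil_iff dest: in_arcsD2 in_arcsD1)

lemma ball_Suc_step: "x \<in> gball v (Suc k) \<Longrightarrow> x = v \<or> (\<exists>w. (v, w) \<in> E \<and> x \<in> gball w k)"
proof -
  assume "x \<in> gball v (Suc k)"
  then obtain p where p: "awalk v p x" "length p \<le> Suc k"
    unfolding graph_ball_def by blast
  show ?thesis
  proof (cases p)
    case Nil then show ?thesis using p by (simp add: awalk_Nil_iff)
  next
    case (Cons e q)
    then have "(v, snd e) \<in> E" "awalk (snd e) q x" "length q \<le> k"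
      using p by (cases e; auto simp: awalk_Cons_iff)+
    then show ?thesis unfolding graph_ball_def by blast
  qed
qed

lemma ball_sym: "x \<in> gball v k \<Longrightarrow> v \<in> gball x k"
proof (induction k arbitrary: v)
  case 0
  then have "v \<in> V" unfolding graph_ball_def by (auto dest: awalk_hd_in_verts)
  with 0 show ?case by (simp add: ball_0)
next
  case (Suc k)
  from ball_Suc_step[OF this(2)] show ?case
  proof
    assume "x = v" then show ?thesis using Suc.prems by simp
  next
    assume "\<exists>w. (v, w) \<in> E \<and> x \<in> gball w k"
    then obtain w where "(v, w) \<in> E" "x \<in> gball w k" by blast
    then have "w \<in> gball x k" "v \<in> gball w (Suc 0)" using Suc.IH arc_sym ball_arc by blast+
    then show ?thesis using ball_trans by fastforce
  qed
qed

lemma ball_Suc_last: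
  assumes "x \<in> gball v (Suc k)"
  shows "x = v \<or> (\<exists>u\<in>gball v k. (u, x) \<in> E)"
  using ball_Suc_step[OF ball_sym[OF assms]] ball_sym arc_sym by metis

lemma finite_ball: "v \<in> V \<Longrightarrow> finite (gball v k)"
proof (induction k)
  case 0 then show ?case by (simp add: ball_0)
next
  case (Suc k)
  have "gball v (Suc k) \<subseteq> insert v (\<Union>u\<in>gball v k. snd ` out_arcs (with_proj T) u)"
    using ball_Suc_last by (force simp: out_arcs_def)
  moreover have "finite (\<Union>u\<in>gball v k. snd ` out_arcs (with_proj T) u)"
    using Suc locally_finite ball_subset[of v k] unfolding locally_finite_graph_def by blast
  ultimately show ?case by (meson finite.insertI finite_subset)
qed

lemma in_some_ball: "u \<in> V \<Longrightarrow> v \<in> V \<Longrightarrow> \<exists>k. v \<in> gball u k"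
  using connected[of u v] unfolding graph_ball_def by auto

section \<open>Absence of cycles and the orientation of a tree towards a root\<close>

lemma no_cycle:
  assumes "successively (\<lambda>x y. (x, y) \<in> E) xs" "distinct xs" "3 \<le> length xs"
    and "(last xs, hd xs) \<in> E"
  shows False
proof -
  have walk: "pcas u (zip (u # ys) ys) (last (u # ys)) \<and> pawalk_verts u (zip (u # ys) ys) = u # ys
      \<and> set (zip (u # ys) ys) \<subseteq> E" if "successively (\<lambda>x y. (x, y) \<in> E) (u # ys)" for u ys
    using that by (induction ys arbitrary: u) auto
  have xs: "xs \<noteq> []" using assms(3) by auto
  \<comment> \<open>Pairing each vertex with its predecessor, the last vertex being put in front,
    lists the arcs of the closed walk. There are as many arcs as vertices in \<open>xs\<close>, so
    the bound three carries over to the cycle.\<close>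
  let ?p = "zip (last xs # xs) xs"
  have s: "successively (\<lambda>x y. (x, y) \<in> E) (last xs # xs)"
    using assms xs by (cases xs) auto
  have "awalk (last xs) ?p (last xs)"
    using walk[OF s] xs assms(4) in_arcsD1 unfolding awalk_def by auto
  moreover have "distinct (tl (pawalk_verts (last xs) ?p))"
    using walk[OF s] assms(2) by simp
  moreover have "3 \<le> length ?p" using assms(3) by simp
  moreover have "?p \<noteq> []" using xs by (cases xs) auto
  ultimately show False
    using tree unfolding undirected_tree_def cycle_def by blast
qed

text \<open>With \<open>d\<close> the distance from \<open>v0\<close>, an arc inside a level or a
  second neighbour nearer to \<open>v0\<close> would close two descending paths up to a cycle. So
  every arc joins a vertex to its parent, and recursion and induction can proceed outwards from
  \<open>v0\<close>.\<close>

lemma rooted: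
  assumes v0: "v0 \<in> V"
  obtains p d where "d v0 = (0::nat)"
    and "\<And>v. v \<in> V \<Longrightarrow> v \<noteq> v0 \<Longrightarrow> (p v, v) \<in> E \<and> d v = Suc (d (p v))"
    and "\<And>u v. (u, v) \<in> E \<Longrightarrow> (v \<noteq> v0 \<and> u = p v) \<or> (u \<noteq> v0 \<and> v = p u)"
proof -
  define d where "d v = (LEAST k. v \<in> gball v0 k)" for v
  have d_in: "v \<in> gball v0 (d v)" if "v \<in> V" for v
    using in_some_ball[OF v0 that] unfolding d_def by (auto intro: LeastI)
  have d_le: "d v \<le> k" if "v \<in> gball v0 k" for v k
    using that unfolding d_def by (rule Least_le)
  have d_arc: "d v \<le> Suc (d u)" if "(u, v) \<in> E" for u v
    using d_le[OF ball_trans[OF d_in ball_arc[OF that]]] in_arcsD1[OF that] by simp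
  have parent: "\<exists>u. (u, v) \<in> E \<and> d v = Suc (d u)" if v: "v \<in> V" "v \<noteq> v0" for v
  proof -
    have "d v \<noteq> 0" using d_in[OF v(1)] v(2) ball_0[OF v0] by (metis singletonD)
    then obtain n where n: "d v = Suc n" using not0_implies_Suc by blast
    then obtain u where u: "u \<in> gball v0 n" "(u, v) \<in> E"
      using ball_Suc_last[of v v0 n] d_in[OF v(1)] v(2) by metis
    then have "d u \<le> n" using d_le by blast
    with d_arc[OF u(2)] n u show ?thesis by auto
  qed
  have root: "v = v0" if "d v = 0" "v \<in> V" for v
    using parent[OF that(2)] that(1) by (metis old.nat.distinct(2))
  \<comment> \<open>Following parents from two distinct vertices of a level until the paths meet
    gives a simple path whose inner vertices lie strictly nearer to \<open>v0\<close>. This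
    strictness keeps the path simple when it is prolonged at both ends.\<close>
  have link: "\<exists>m. m \<noteq> [] \<and> successively (\<lambda>x y. (x, y) \<in> E) (u # m @ [u'])
      \<and> distinct (u # m @ [u']) \<and> (\<forall>x\<in>set m. d x < n)"
    if "u \<in> V" "u' \<in> V" "d u = n" "d u' = n" "u \<noteq> u'" for u u' n
    using that
  proof (induction n arbitrary: u u')
    case 0 then show ?case using root by metis
  next
    case (Suc n)
    have "d v0 = 0" using d_le[OF ball_center[OF v0, of 0]] by simp
    then have "u \<noteq> v0" "u' \<noteq> v0" using Suc.prems(3,4) by force+
    from parent[OF Suc.prems(1) this(1)] parent[OF Suc.prems(2) this(2)]
    obtain a a' where a: "(a, u) \<in> E" "d a = n" "(a', u') \<in> E" "d a' = n"
      using Suc.prems(3,4) by auto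
    show ?case
    proof (cases "a = a'")
      case True
      then show ?thesis using a Suc.prems(3-5) arc_sym[OF a(1)] by (intro exI[of _ "[a]"]) auto
    next
      case False
      have "a \<in> V" "a' \<in> V" using a in_arcsD1 by blast+
      then obtain m where m: "m \<noteq> []" "successively (\<lambda>x y. (x, y) \<in> E) (a # m @ [a'])"
          "distinct (a # m @ [a'])" "\<forall>x\<in>set m. d x < n"
        using Suc.IH[OF _ _ a(2,4) False] by blast
      have "successively (\<lambda>x y. (x, y) \<in> E) (u # (a # m @ [a']) @ [u'])"
        using m(2) a(3) arc_sym[OF a(1)] by (auto simp: successively_append_iff successively_Cons hd_append)
      moreover have "distinct (u # (a # m @ [a']) @ [u'])"
        using m(3,4) a(2,4) Suc.prems(3-5) by auto
      ultimately show ?thesis using m a by (intro exI[of _ "a # m @ [a']"]) auto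
    qed
  qed
  \<comment> \<open>The arc itself closes the path given by \<open>link\<close>; as \<open>m\<close>
    is nonempty, the cycle has at least three vertices.\<close>
  have no_level: "d u \<noteq> d v" if uv: "(u, v) \<in> E" for u v
  proof
    assume "d u = d v"
    moreover have "u \<noteq> v" using uv pair_no_loops by fastforce
    ultimately obtain m where m: "m \<noteq> []" "successively (\<lambda>x y. (x, y) \<in> E) (u # m @ [v])"
          "distinct (u # m @ [v])"
      using link uv in_arcsD1 in_arcsD2 by metis
    moreover have "3 \<le> length (u # m @ [v])" using m(1) by (cases m) auto
    moreover have "(last (u # m @ [v]), hd (u # m @ [v])) \<in> E" using arc_sym[OF uv] by simp
    ultimately show False using no_cycle by blast
  qed
  \<comment> \<open>The common neighbour \<open>v\<close>, one level further out than the whole path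
    between \<open>u\<close> and \<open>u'\<close>, closes it to a cycle.\<close>
  have unique: "u = u'" if uv: "(u, v) \<in> E" "(u', v) \<in> E" "d v = Suc (d u)" "d v = Suc (d u')" for u u' v
  proof (rule ccontr)
    assume "u \<noteq> u'"
    then obtain m where m: "m \<noteq> []" "successively (\<lambda>x y. (x, y) \<in> E) (u # m @ [u'])"
          "distinct (u # m @ [u'])" "\<forall>x\<in>set m. d x < d u"
      using link uv in_arcsD1 by (metis old.nat.inject)
    have "successively (\<lambda>x y. (x, y) \<in> E) (v # u # m @ [u'])"
      using m uv arc_sym by simp
    moreover have "distinct (v # u # m @ [u'])"
      using m uv by auto
    moreover have "3 \<le> length (v # u # m @ [u'])" by simp
    moreover have "(last (v # u # m @ [u']), hd (v # u # m @ [u'])) \<in> E" using uv by simp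
    ultimately show False using no_cycle by blast
  qed
  define p where "p v = (SOME u. (u, v) \<in> E \<and> d v = Suc (d u))" for v
  have p: "(p v, v) \<in> E \<and> d v = Suc (d (p v))" if "v \<in> V" "v \<noteq> v0" for v
    using someI_ex[OF parent[OF that]] unfolding p_def .
  show thesis
  proof
    show d0: "d v0 = 0" using d_le[OF ball_center[OF v0, of 0]] by simp
    show "(p v, v) \<in> E \<and> d v = Suc (d (p v))" if "v \<in> V" "v \<noteq> v0" for v using p that .
    show "(v \<noteq> v0 \<and> u = p v) \<or> (u \<noteq> v0 \<and> v = p u)" if a: "(u, v) \<in> E" for u v
    proof -
      have "d v = Suc (d u) \<or> d u = Suc (d v)"
        using d_arc[OF a] d_arc[OF arc_sym[OF a]] no_level[OF a] by auto
      then show ?thesis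
      proof
        assume *: "d v = Suc (d u)"
        then have "v \<noteq> v0" using d0 by auto
        then show ?thesis using unique[OF a _ *] p[OF in_arcsD2[OF a]] by blast
      next
        assume *: "d u = Suc (d v)"
        then have "u \<noteq> v0" using d0 by auto
        then show ?thesis using unique[OF arc_sym[OF a] _ *] p[OF in_arcsD1[OF a]] by blast
      qed
    qed
  qed
qed

section \<open>The automorphism group and its Chabauty neighbourhoods\<close>

abbreviation "A \<equiv> Aut T"
abbreviation "X \<equiv> Aut_top T"

lemma carrier_Aut: "carrier A = graph_auts T"
  by (simp add: Aut_def)

lemma Aut_bij: "f \<in> carrier A \<Longrightarrow> bij_betw f V V"
  by (simp add: carrier_Aut graph_auts_def Bij_def)

lemma Aut_closed: "f \<in> carrier A \<Longrightarrow> v \<in> V \<Longrightarrow> f v \<in> V"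
  using Aut_bij bij_betwE by blast

lemma Aut_inj: "f \<in> carrier A \<Longrightarrow> u \<in> V \<Longrightarrow> v \<in> V \<Longrightarrow> f u = f v \<longleftrightarrow> u = v"
  using Aut_bij by (metis bij_betw_inv_into_left)

lemma Aut_surj: "f \<in> carrier A \<Longrightarrow> v \<in> V \<Longrightarrow> \<exists>u\<in>V. f u = v"
  using Aut_bij unfolding bij_betw_def by (metis imageE)

lemma Aut_arc: "f \<in> carrier A \<Longrightarrow> u \<in> V \<Longrightarrow> v \<in> V \<Longrightarrow> (f u, f v) \<in> E \<longleftrightarrow> (u, v) \<in> E"
  by (simp add: carrier_Aut graph_auts_def)

lemma Aut_memI:
  assumes "f \<in> extensional V" "bij_betw f V V"
    and "\<And>u v. u \<in> V \<Longrightarrow> v \<in> V \<Longrightarrow> (f u, f v) \<in> E \<longleftrightarrow> (u, v) \<in> E"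
  shows "f \<in> carrier A"
  using assms by (simp add: carrier_Aut graph_auts_def Bij_def)

lemma mult_apply: "f \<in> carrier A \<Longrightarrow> g \<in> carrier A \<Longrightarrow> v \<in> V \<Longrightarrow> (f \<otimes>\<^bsub>A\<^esub> g) v = f (g v)"
  by (simp add: carrier_Aut Aut_def BijGroup_def graph_auts_def compose_def)

lemma one_apply: "v \<in> V \<Longrightarrow> \<one>\<^bsub>A\<^esub> v = v"
  by (simp add: Aut_def BijGroup_def)

lemma group_Aut: "group A"
proof -
  interpret BG: group "BijGroup V" by (rule group_BijGroup)
  have "subgroup (graph_auts T) (BijGroup V)"
  proof (rule BG.subgroupI)
    show "graph_auts T \<subseteq> carrier (BijGroup V)"
      by (auto simp: graph_auts_def BijGroup_def)
    have "(\<lambda>x\<in>V. x) \<in> graph_auts T"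
      by (auto simp: graph_auts_def id_Bij)
    then show "graph_auts T \<noteq> {}" by blast
  next
    fix f assume f: "f \<in> graph_auts T"
    then have fB: "f \<in> Bij V" by (simp add: graph_auts_def)
    have inv: "inv_into V f v \<in> V" "f (inv_into V f v) = v" if "v \<in> V" for v
      using fB that by (auto simp: Bij_def bij_betw_def inv_into_into f_inv_into_f)
    have "(inv_into V f u, inv_into V f v) \<in> E \<longleftrightarrow> (u, v) \<in> E" if "u \<in> V" "v \<in> V" for u v
      using Aut_arc[of f "inv_into V f u" "inv_into V f v"] f inv that by (simp add: carrier_Aut)
    then show "inv\<^bsub>BijGroup V\<^esub> f \<in> graph_auts T"
      using restrict_inv_into_Bij[OF fB] by (simp add: graph_auts_def inv_BijGroup[OF fB])
  next
    fix f g assume "f \<in> graph_auts T" "g \<in> graph_auts T"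
    then show "f \<otimes>\<^bsub>BijGroup V\<^esub> g \<in> graph_auts T"
      using Aut_closed[of g]
      by (auto simp: carrier_Aut graph_auts_def BijGroup_def compose_Bij compose_eq)
  qed
  then show ?thesis
    unfolding Aut_def by (rule BG.subgroup_imp_group)
qed

lemma inv_apply_left: "f \<in> carrier A \<Longrightarrow> v \<in> V \<Longrightarrow> (inv\<^bsub>A\<^esub> f) (f v) = v"
  using mult_apply[of "inv\<^bsub>A\<^esub> f" f v] group.l_inv[OF group_Aut] group.inv_closed[OF group_Aut] one_apply
  by simp

lemma Aut_ball_image:
  assumes f: "f \<in> carrier A" and v: "v \<in> V" and x: "x \<in> gball v k"
  shows "f x \<in> gball (f v) k"
  using v x
proof (induction k arbitrary: v)
  case 0 then show ?case using Aut_closed[OF f] by (simp add: ball_0)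
next
  case (Suc k)
  from ball_Suc_step[OF Suc.prems(2)] show ?case
  proof
    assume "x = v" then show ?thesis using Aut_closed[OF f] Suc.prems ball_center by simp
  next
    assume "\<exists>w. (v, w) \<in> E \<and> x \<in> gball w k"
    then obtain w where w: "(v, w) \<in> E" "x \<in> gball w k" by blast
    then have "f x \<in> gball (f w) k" using Suc.IH in_arcsD2 by blast
    moreover have "(f v, f w) \<in> E" using Aut_arc[OF f] w(1) in_arcsD1 in_arcsD2 by blast
    then have "f w \<in> gball (f v) (Suc 0)" by (rule ball_arc)
    ultimately show ?thesis using ball_trans[of "f w" "f v" "Suc 0" "f x" k] by simp
  qed
qed

lemma Aut_ball_iff:
  assumes f: "f \<in> carrier A" and v: "v \<in> V" and x: "x \<in> V"
  shows "f x \<in> gball (f v) k \<longleftrightarrow> x \<in> gball v k"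
proof
  assume "f x \<in> gball (f v) k"
  then have "(inv\<^bsub>A\<^esub> f) (f x) \<in> gball ((inv\<^bsub>A\<^esub> f) (f v)) k"
    by (rule Aut_ball_image[OF group.inv_closed[OF group_Aut f] Aut_closed[OF f v]])
  then show "x \<in> gball v k" using f v x by (simp add: inv_apply_left)
next
  show "x \<in> gball v k \<Longrightarrow> f x \<in> gball (f v) k" using Aut_ball_image f v by blast
qed

lemma subgroup_ball_fixator: "v0 \<in> V \<Longrightarrow> subgroup (ball_fixator T v0 n) A"
proof (rule group.subgroupI[OF group_Aut])
  show "ball_fixator T v0 n \<subseteq> carrier A" by (auto simp: ball_fixator_def)
  have "\<one>\<^bsub>A\<^esub> \<in> ball_fixator T v0 n"
    using ball_subset[of v0 n] monoid.one_closed[OF group.is_monoid[OF group_Aut]]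
    by (simp add: ball_fixator_def one_apply subset_iff)
  then show "ball_fixator T v0 n \<noteq> {}" by blast
next
  fix f assume "f \<in> ball_fixator T v0 n"
  then have f: "f \<in> carrier A" "\<And>w. w \<in> gball v0 n \<Longrightarrow> f w = w"
    by (auto simp: ball_fixator_def)
  have "(inv\<^bsub>A\<^esub> f) w = w" if "w \<in> gball v0 n" for w
    using inv_apply_left[OF f(1), of w] f(2)[OF that] that ball_subset by (metis subsetD)
  then show "inv\<^bsub>A\<^esub> f \<in> ball_fixator T v0 n"
    using group.inv_closed[OF group_Aut f(1)] by (simp add: ball_fixator_def)
next
  fix f g assume fg: "f \<in> ball_fixator T v0 n" "g \<in> ball_fixator T v0 n"
  then have "f \<otimes>\<^bsub>A\<^esub> g \<in> carrier A"
    using monoid.m_closed[OF group.is_monoid[OF group_Aut]] by (simp add: ball_fixator_def)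
  then show "f \<otimes>\<^bsub>A\<^esub> g \<in> ball_fixator T v0 n"
    using fg ball_subset[of v0 n] by (simp add: ball_fixator_def mult_apply subset_iff)
qed

section \<open>Pointwise convergence and compact sets of automorphisms\<close>

abbreviation "P \<equiv> product_topology (\<lambda>_. discrete_topology V) V"

text \<open>The factors are discrete, so any condition on two coordinates is a union of cylinder
  sets. Two coordinates suffice to express preservation of arcs and injectivity.\<close>

lemma open_coordinates:
  assumes "u \<in> V" "v \<in> V"
  shows "openin P {f \<in> topspace P. Q (f u) (f v)}"
proof -
  have 1: "openin P {f \<in> topspace P. f w \<in> S}" if "w \<in> V" for w S
  proof -
    \<comment> \<open>Open sets of a factor must lie in \<open>V\<close>, hence the intersection
      with \<open>V\<close>; on \<open>topspace P\<close> it changes nothing.\<close>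
    have "openin P {f \<in> topspace P. f w \<in> S \<inter> V}"
      by (rule openin_continuous_map_preimage[OF continuous_map_product_projection]) (auto simp: that)
    moreover have "{f \<in> topspace P. f w \<in> S \<inter> V} = {f \<in> topspace P. f w \<in> S}"
      using that by (auto simp: PiE_iff)
    ultimately show ?thesis by simp
  qed
  have "{f \<in> topspace P. Q (f u) (f v)}
      = (\<Union>a\<in>UNIV. {f \<in> topspace P. f u \<in> {a}} \<inter> {f \<in> topspace P. f v \<in> Collect (Q a)})"
    by auto
  also have "openin P \<dots>"
    by (intro openin_Union ballI) (elim imageE, simp only:, intro openin_Int 1 assms)
  finally show ?thesis .
qed

lemma closed_coordinates:
  assumes "u \<in> V" "v \<in> V"
  shows "closedin P {f \<in> topspace P. Q (f u) (f v)}"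
proof -
  have "topspace P - {f \<in> topspace P. Q (f u) (f v)} = {f \<in> topspace P. \<not> Q (f u) (f v)}"
    by blast
  then show ?thesis
    using open_coordinates[OF assms, of "\<lambda>a b. \<not> Q a b"]
    unfolding closedin_def by (simp del: topspace_product_topology)
qed

lemma graph_auts_subset_topspace: "graph_auts T \<subseteq> topspace P"
  by (auto simp: graph_auts_def Bij_def bij_betw_def PiE_iff extensional_def)

text \<open>Local finiteness enters here: the ball is finite, so only finitely many open conditions
  are intersected.\<close>

lemma openin_ball_fixator:
  assumes v0: "v0 \<in> V"
  shows "openin X (ball_fixator T v0 n)"
proof -
  have "openin P (topspace P \<inter> (\<Inter>w\<in>gball v0 n. {f \<in> topspace P. f w = w}))"
  proof -
    have "openin P (\<Inter>w\<in>gball v0 n. {f \<in> topspace P. f w = w})"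
      using ball_subset[of v0 n] finite_ball[OF v0, of n] ball_center[OF v0, of n]
      by (intro openin_Inter) (auto intro!: open_coordinates simp del: topspace_product_topology)
    then show ?thesis by blast
  qed
  moreover have "ball_fixator T v0 n
      = topspace P \<inter> (\<Inter>w\<in>gball v0 n. {f \<in> topspace P. f w = w}) \<inter> graph_auts T"
    using graph_auts_subset_topspace unfolding ball_fixator_def carrier_Aut by blast
  ultimately show ?thesis
    unfolding Aut_top_def openin_subtopology by blast
qed

text \<open>
  Surjectivity of a limit of automorphisms needs local finiteness: the preimage of a vertex
  stays in a finite ball.
\<close>

lemma compactin_Aut:
  assumes v0: "v0 \<in> V"
  shows "compactin X {g \<in> carrier A. g v0 \<in> gball v0 m}" (is "compactin X ?K")
proof -
  obtain d where d: "\<And>v. v \<in> V \<Longrightarrow> v \<in> gball v0 (d v)"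
    using in_some_ball[OF v0] by metis
  \<comment> \<open>If \<open>g v0\<close> is within \<open>m\<close> of \<open>v0\<close>, then
    both \<open>g v\<close> and the preimage of \<open>v\<close> under \<open>g\<close> are within
    \<open>m + d v\<close> of \<open>v0\<close>. So the same finite sets bound the values of
    \<open>g\<close> and the search for preimages.\<close>
  define D where "D v = gball v0 (m + d v)" for v
  have D_fin: "finite (D v)" for v using finite_ball[OF v0] by (simp add: D_def)
  have D_sub: "D v \<subseteq> V" for v using ball_subset by (simp add: D_def)
  \<comment> \<open>Each condition defining an automorphism is written as a closed one. Surjectivity
    becomes closed because the union over \<open>D w\<close> is finite.\<close>
  define C where "C = topspace P \<inter> {f \<in> topspace P. f v0 \<in> gball v0 m}
    \<inter> (\<Inter>u\<in>V. \<Inter>v\<in>V. {f \<in> topspace P. ((f u, f v) \<in> E \<longleftrightarrow> (u, v) \<in> E) \<and> (f u = f v \<longrightarrow> u = v)})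
    \<inter> (\<Inter>w\<in>V. \<Union>u\<in>D w. {f \<in> topspace P. f u = w})"
  have "closedin P (\<Union>u\<in>D w. {f \<in> topspace P. f u = w})" for w
    using D_fin D_sub[of w]
    by (intro closedin_Union) (auto intro!: closed_coordinates simp del: topspace_product_topology)
  then have "closedin P C"
    unfolding C_def using v0
    by (intro closedin_Int closedin_Inter)
      (auto intro!: closed_coordinates simp del: topspace_product_topology)
  have C_iff: "g \<in> C \<longleftrightarrow> g \<in> topspace P \<and> g v0 \<in> gball v0 m
      \<and> (\<forall>u\<in>V. \<forall>v\<in>V. ((g u, g v) \<in> E \<longleftrightarrow> (u, v) \<in> E) \<and> (g u = g v \<longrightarrow> u = v))
      \<and> (\<forall>w\<in>V. \<exists>u\<in>D w. g u = w)" for g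
    unfolding C_def by (simp only: Int_iff INT_iff UN_iff mem_Collect_eq) blast
  have 1: "compactin P (PiE V D)"
    using D_fin D_sub by (auto simp: compactin_PiE compactin_discrete_topology)
  have K: "?K = PiE V D \<inter> C"
  proof (intro equalityI subsetI)
    fix g assume "g \<in> ?K"
    then have g: "g \<in> carrier A" "g v0 \<in> gball v0 m" by auto
    have gP: "g \<in> topspace P" using graph_auts_subset_topspace g(1) carrier_Aut by blast
    have "g v \<in> D v" if "v \<in> V" for v
      using ball_trans[OF g(2) Aut_ball_image[OF g(1) v0 d[OF that]]] by (simp add: D_def)
    then have "g \<in> PiE V D" using gP by (auto simp: PiE_iff)
    moreover have "\<exists>u\<in>D w. g u = w" if w: "w \<in> V" for w
    proof -
      obtain u where u: "u \<in> V" "g u = w" using Aut_surj[OF g(1) w] by blast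
      have "v0 \<in> gball w (d w)" using ball_sym d[OF w] by blast
      then have "g v0 \<in> gball w (d w + m)" using ball_trans[OF _ g(2)] by blast
      then have "v0 \<in> gball u (d w + m)" using u v0 Aut_ball_iff[OF g(1)] by blast
      then show ?thesis using ball_sym u by (auto simp: D_def add.commute)
    qed
    ultimately show "g \<in> PiE V D \<inter> C"
      unfolding Int_iff C_iff using g(2) gP Aut_arc[OF g(1)] Aut_inj[OF g(1)] by blast
  next
    fix g assume "g \<in> PiE V D \<inter> C"
    then have g: "g \<in> PiE V D" "g \<in> C" by blast+
    note gC = g(2)[unfolded C_iff]
    have "g ` V \<subseteq> V" using g(1) D_sub by (meson PiE_mem image_subsetI subsetD)
    moreover have "V \<subseteq> g ` V"
    proof
      fix w assume "w \<in> V"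
      then obtain u where "u \<in> D w" "g u = w" using gC by blast
      then show "w \<in> g ` V" using D_sub by blast
    qed
    moreover have "inj_on g V" using gC by (intro inj_onI) blast
    ultimately have "bij_betw g V V" unfolding bij_betw_def by blast
    moreover have "g \<in> extensional V" using g(1) by (simp add: PiE_iff)
    ultimately have "g \<in> carrier A" using gC by (intro Aut_memI) blast+
    then show "g \<in> ?K" using gC by simp
  qed
  have "compactin P ?K"
    unfolding K by (rule compact_Int_closedin) fact+
  moreover have "?K \<subseteq> graph_auts T" unfolding carrier_Aut by blast
  ultimately show ?thesis
    unfolding Aut_top_def compactin_subtopology by blast
qed

end

section \<open>Basic Chabauty neighbourhoods that are open\<close>

text \<open>
  Since \<open>K U = K\<close>, membership of \<open>J\<close> in the basic neighbourhood says \<open>J U \<inter> K = H U \<inter> K\<close>,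
  which is a condition symmetric in \<open>J\<close> and \<open>H\<close>.
\<close>

lemma openin_chabauty_nbhd:
  fixes G (structure)
  assumes "group G" and HG: "H \<subseteq> carrier G"
    and K: "compactin X K" and U: "openin X U" "subgroup U G"
    and KU: "\<And>g u. g \<in> K \<Longrightarrow> u \<in> U \<Longrightarrow> g \<otimes> u \<in> K"
  shows "openin (chabauty G X) (chabauty_nbhd G X H K U)"
proof -
  interpret group G by fact
  interpret U: subgroup U G by fact
  \<comment> \<open>This is transitivity of the relation between \<open>I\<close> and
    \<open>J\<close> given by the first inclusion. Dividing \<open>g = j u\<close> by
    \<open>u\<close> stays in \<open>K\<close>, so \<open>j\<close> can in turn be replaced by an
    element of \<open>H'\<close> times one of \<open>U\<close>.\<close>
  have absorb: "I \<inter> K \<subseteq> H' <#> U"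
    if I: "I \<inter> K \<subseteq> J <#> U" and J: "J \<inter> K \<subseteq> H' <#> U" and JG: "J \<subseteq> carrier G" and HG: "H' \<subseteq> carrier G" for I J H'
  proof
    fix g assume g: "g \<in> I \<inter> K"
    then obtain j u where ju: "j \<in> J" "u \<in> U" "g = j \<otimes> u"
      using I unfolding set_mult_def by blast
    then have "j = g \<otimes> inv u" using JG by (auto simp: inv_solve_right subset_iff)
    then have "j \<in> J \<inter> K" using KU[of g "inv u"] g ju by auto
    then obtain h w where hw: "h \<in> H'" "w \<in> U" "j = h \<otimes> w"
      using J unfolding set_mult_def by blast
    then have "g = h \<otimes> (w \<otimes> u)" using ju HG by (auto simp: m_assoc subset_iff)
    then show "g \<in> H' <#> U" using hw ju unfolding set_mult_def by blast
  qed
  \<comment> \<open>By \<open>absorb\<close>, applied once in each direction, \<open>J\<close> has a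
    basic neighbourhood with the same \<open>K\<close> and \<open>U\<close> inside that of
    \<open>H\<close>. This is what makes the latter open.\<close>
  have mono: "chabauty_nbhd G X J K U \<subseteq> chabauty_nbhd G X H K U" if "J \<in> chabauty_nbhd G X H K U" for J
  proof
    fix I assume I: "I \<in> chabauty_nbhd G X J K U"
    have JG: "J \<subseteq> carrier G"
      using that unfolding chabauty_nbhd_def closed_subgroups_def by (auto dest: subgroup.subset)
    have IG: "I \<subseteq> carrier G"
      using I unfolding chabauty_nbhd_def closed_subgroups_def by (auto dest: subgroup.subset)
    show "I \<in> chabauty_nbhd G X H K U"
      using I that absorb[of I J H, OF _ _ JG HG] absorb[of H J I, OF _ _ JG IG]
      unfolding chabauty_nbhd_def by simp
  qed
  show ?thesis
    unfolding openin_chabauty chabauty_open_def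
  proof (intro conjI ballI)
    show "chabauty_nbhd G X H K U \<subseteq> closed_subgroups G X"
      unfolding chabauty_nbhd_def by (rule Collect_restrict)
    fix J assume "J \<in> chabauty_nbhd G X H K U"
    from K U(1) U.one_closed mono[OF this]
    show "\<exists>K' U'. compactin X K' \<and> openin X U' \<and> \<one> \<in> U' \<and>
        chabauty_nbhd G X J K' U' \<subseteq> chabauty_nbhd G X H K U"
      by blast
  qed
qed

section \<open>Gluing local automorphisms\<close>

context lf_tree
begin

text \<open>Values are chosen outwards from \<open>v0\<close>. Every arc joins a parent to a child,
  so no consistency around cycles is needed. The relation \<open>L\<close> may be asymmetric, and it
  is obtained from parent to child; hence the disjunction.\<close>

lemma choice_along_tree:
  assumes v0: "v0 \<in> V" and c0: "Q v0 c0"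
    and step: "\<And>v w c. (v, w) \<in> E \<Longrightarrow> Q v c \<Longrightarrow> \<exists>c'. Q w c' \<and> L v w c c'"
  obtains s where "s v0 = c0" "\<And>v. v \<in> V \<Longrightarrow> Q v (s v)"
    "\<And>v w. (v, w) \<in> E \<Longrightarrow> L v w (s v) (s w) \<or> L w v (s w) (s v)"
proof -
  obtain p d where d0: "d v0 = (0::nat)"
    and p: "\<And>v. v \<in> V \<Longrightarrow> v \<noteq> v0 \<Longrightarrow> (p v, v) \<in> E \<and> d v = Suc (d (p v))"
    and arc: "\<And>u v. (u, v) \<in> E \<Longrightarrow> (v \<noteq> v0 \<and> u = p v) \<or> (u \<noteq> v0 \<and> v = p u)"
    by (rule rooted[OF v0]) blast
  define e where "e v w c = (SOME c'. Q w c' \<and> L v w c c')" for v w c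
  have e: "Q w (e v w c) \<and> L v w c (e v w c)" if "(v, w) \<in> E" "Q v c" for v w c
    using someI_ex[OF step[OF that]] unfolding e_def .
  \<comment> \<open>Stage \<open>n\<close> of the recursion is meant for vertices of depth
    \<open>n\<close>; the definition of \<open>s\<close> reads each vertex at its own depth.\<close>
  define S where "S = rec_nat (\<lambda>_. c0) (\<lambda>_ f w. e (p w) w (f (p w)))"
  define s where "s v = S (d v) v" for v
  have s0: "s v0 = c0" by (simp add: s_def S_def d0)
  have s_Suc: "s v = e (p v) v (s (p v))" if "v \<in> V" "v \<noteq> v0" for v
    using p[OF that] by (simp add: s_def S_def)
  have s_Q: "Q v (s v)" if "v \<in> V" for v
    using that
  proof (induction "d v" arbitrary: v rule: less_induct)
    case less
    show ?case
    proof (cases "v = v0")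
      case True then show ?thesis using c0 s0 by simp
    next
      case False
      note pv = p[OF less.prems False]
      then have "Q (p v) (s (p v))" using less.hyps[of "p v"] in_arcsD1 by auto
      then show ?thesis using e pv s_Suc[OF less.prems False] by metis
    qed
  qed
  have child: "L (p w) w (s (p w)) (s w)" if "w \<in> V" "w \<noteq> v0" for w
    using e[of "p w" w "s (p w)"] p[OF that] s_Suc[OF that] s_Q[of "p w"] in_arcsD1 by metis
  show thesis
  proof (rule that[OF s0 s_Q])
    show "L v w (s v) (s w) \<or> L w v (s w) (s v)" if vw: "(v, w) \<in> E" for v w
      using arc[OF vw] child[OF in_arcsD1[OF vw]] child[OF in_arcsD2[OF vw]] by auto
  qed
qed

text \<open>A locally injective map of trees cannot fold: paths without backtracking stay so. Hence
  \<sigma>, which fixes the root, preserves depths and commutes with taking parents, and two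
  vertices with equal images can be compared through their parents.\<close>

lemma local_iso_inj:
  assumes v0: "v0 \<in> V" and fix0: "\<sigma> v0 = v0"
    and loc: "\<And>v. v \<in> V \<Longrightarrow> \<exists>a\<in>carrier A. \<forall>x\<in>gball v (Suc 0). \<sigma> x = a x"
  shows "inj_on \<sigma> V"
proof -
  obtain p d where d0: "d v0 = (0::nat)"
    and p: "\<And>v. v \<in> V \<Longrightarrow> v \<noteq> v0 \<Longrightarrow> (p v, v) \<in> E \<and> d v = Suc (d (p v))"
    and arc: "\<And>u v. (u, v) \<in> E \<Longrightarrow> (v \<noteq> v0 \<and> u = p v) \<or> (u \<noteq> v0 \<and> v = p u)"
    by (rule rooted[OF v0]) blast
  have \<sigma>_V: "\<sigma> v \<in> V" if "v \<in> V" for v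
    using loc[OF that] ball_center[OF that, of "Suc 0"] Aut_closed[OF _ that] by force
  have \<sigma>_arc: "(\<sigma> u, \<sigma> v) \<in> E" if "(u, v) \<in> E" for u v
  proof -
    have uv: "u \<in> V" "v \<in> V" using in_arcsD1 in_arcsD2 that by blast+
    obtain a where "a \<in> carrier A" "\<forall>x\<in>gball u (Suc 0). \<sigma> x = a x" using loc[OF uv(1)] by blast
    then show ?thesis
      using Aut_arc[of a u v] uv that ball_center[OF uv(1)] ball_arc[OF that] by simp
  qed
  have \<sigma>_loc_inj: "x = y" if "x \<in> gball v (Suc 0)" "y \<in> gball v (Suc 0)" "\<sigma> x = \<sigma> y" "v \<in> V" for v x y
  proof -
    obtain a where a: "a \<in> carrier A" "\<forall>x\<in>gball v (Suc 0). \<sigma> x = a x"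
      using loc[OF \<open>v \<in> V\<close>] by blast
    have "x \<in> V" "y \<in> V" using that(1,2) ball_subset by blast+
    then show ?thesis using Aut_inj[OF a(1)] a(2) that(1-3) by simp
  qed
  have parent: "\<sigma> w \<noteq> v0 \<and> p (\<sigma> w) = \<sigma> (p w) \<and> d (\<sigma> w) = d w" if "w \<in> V" "w \<noteq> v0" for w
    using that
  proof (induction "d w" arbitrary: w rule: less_induct)
    case less
    let ?v = "p w"
    have v: "(?v, w) \<in> E" "d w = Suc (d ?v)" "?v \<in> V"
      using p[OF less.prems] in_arcsD1 by auto
    \<comment> \<open>If \<sigma> turned back towards the root at \<open>?v\<close>, then
      \<open>w\<close> and the parent of \<open>?v\<close>, both neighbours of \<open>?v\<close>,
      would have the same image. Local injectivity would identify them although their depths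
      differ.\<close>
    have "\<not> (\<sigma> ?v \<noteq> v0 \<and> \<sigma> w = p (\<sigma> ?v))"
    proof
      assume *: "\<sigma> ?v \<noteq> v0 \<and> \<sigma> w = p (\<sigma> ?v)"
      then have "?v \<noteq> v0" using fix0 by auto
      then have "\<sigma> w = \<sigma> (p ?v)" using less.hyps[of ?v] v(2,3) * by simp
      moreover have "(p ?v, ?v) \<in> E" "d ?v = Suc (d (p ?v))"
        using p[OF v(3) \<open>?v \<noteq> v0\<close>] by auto
      ultimately have "w = p ?v"
        using \<sigma>_loc_inj[OF ball_arc[OF v(1)] ball_arc[OF arc_sym] _ v(3)] by blast
      then show False using v(2) \<open>d ?v = Suc (d (p ?v))\<close> by simp
    qed
    then have *: "\<sigma> w \<noteq> v0" "\<sigma> ?v = p (\<sigma> w)" using arc[OF \<sigma>_arc[OF v(1)]] by auto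
    moreover have "d (\<sigma> ?v) = d ?v"
      using less.hyps[of ?v] v(2,3) fix0 by (cases "?v = v0") simp_all
    ultimately show ?case using p[OF \<sigma>_V[OF less.prems(1)] *(1)] v(2) by simp
  qed
  \<comment> \<open>By induction \<open>u\<close> and \<open>v\<close> have the same parent, so both
    lie in one ball of radius one, on which \<sigma> is injective.\<close>
  have "u = v" if "u \<in> V" "v \<in> V" "\<sigma> u = \<sigma> v" for u v
    using that
  proof (induction "d u" arbitrary: u v rule: less_induct)
    case less
    show ?case
    proof (cases "u = v0 \<or> v = v0")
      case True then show ?thesis
        using parent[OF less.prems(1)] parent[OF less.prems(2)] less.prems(3) fix0 by metis
    next
      case False
      then have n: "u \<noteq> v0" "v \<noteq> v0" by auto
      have pu: "(p u, u) \<in> E" "d u = Suc (d (p u))" "(p v, v) \<in> E"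
        using p[OF less.prems(1) n(1)] p[OF less.prems(2) n(2)] by auto
      have "\<sigma> (p u) = \<sigma> (p v)"
        using parent[OF less.prems(1) n(1)] parent[OF less.prems(2) n(2)] less.prems(3) by simp
      then have "p u = p v"
        using less.hyps[of "p u" "p v"] pu(2) in_arcsD1[OF pu(1)] in_arcsD1[OF pu(3)] by simp
      then show ?thesis
        using \<sigma>_loc_inj[OF ball_arc[OF pu(1)] _ less.prems(3) in_arcsD1[OF pu(1)]] ball_arc[OF pu(3)]
        by simp
    qed
  qed
  then show ?thesis by (rule inj_onI)
qed

text \<open>Compatibility along arcs makes the map sending \<open>v\<close> to \<open>s v v\<close>
  agree with \<open>s v\<close> on the whole \<open>k\<close>-ball around \<open>v\<close>. As
  \<open>k\<close> is positive, this ball contains the neighbours of \<open>v\<close>, so the glued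
  map is locally an automorphism; on a tree this forces bijectivity.\<close>

lemma glue_automorphisms:
  assumes v0: "v0 \<in> V" and k: "0 < k"
    and s: "\<And>v. v \<in> V \<Longrightarrow> s v \<in> carrier A" and s0: "s v0 v0 = v0"
    and compat: "\<And>v w x. (v, w) \<in> E \<Longrightarrow> x \<in> gball v k \<Longrightarrow> x \<in> gball w k \<Longrightarrow> s v x = s w x"
  obtains \<sigma> where "\<sigma> \<in> carrier A" "\<And>v x. v \<in> V \<Longrightarrow> x \<in> gball v k \<Longrightarrow> \<sigma> x = s v x"
proof -
  define \<sigma> where "\<sigma> = (\<lambda>v\<in>V. s v v)"
  \<comment> \<open>On a walk of length at most \<open>k\<close> from \<open>v\<close> to
    \<open>x\<close>, every vertex is within \<open>k\<close> of \<open>x\<close>. So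
    \<open>compat\<close> applies at each arc of the walk.\<close>
  have eq: "s v x = s x x" if "v \<in> V" "i \<le> k" "x \<in> gball v i" for v x i
    using that
  proof (induction i arbitrary: v)
    case 0 then show ?case by (simp add: ball_0)
  next
    case (Suc i)
    from ball_Suc_step[OF Suc.prems(3)] show ?case
    proof
      assume "\<exists>w. (v, w) \<in> E \<and> x \<in> gball w i"
      then obtain w where w: "(v, w) \<in> E" "x \<in> gball w i" by blast
      have "x \<in> gball v k" "x \<in> gball w k"
        using w Suc.prems ball_mono[of "Suc i" k v] ball_mono[of i k w] by auto
      then show ?thesis using compat[OF w(1)] Suc.IH[OF _ _ w(2)] in_arcsD2[OF w(1)] Suc.prems by simp
    qed simp
  qed
  have \<sigma>: "\<sigma> x = s v x" if "v \<in> V" "x \<in> gball v k" for v x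
    using eq[OF that(1) order_refl that(2)] ball_subset that by (auto simp: \<sigma>_def)
  have \<sigma>1: "\<sigma> x = s v x" if "v \<in> V" "x \<in> gball v (Suc 0)" for v x
    using \<sigma> that ball_mono[of "Suc 0" k v] k by auto
  have \<sigma>_self: "\<sigma> v = s v v" if "v \<in> V" for v using that by (simp add: \<sigma>_def)
  have inj: "inj_on \<sigma> V"
    using v0
  proof (rule local_iso_inj)
    show "\<sigma> v0 = v0" using s0 v0 \<sigma>_self by simp
    show "\<exists>a\<in>carrier A. \<forall>x\<in>gball v (Suc 0). \<sigma> x = a x" if "v \<in> V" for v
      using s \<sigma>1 that by blast
  qed
  \<comment> \<open>Arcs lift through \<sigma>. Lifting walks from \<open>v0\<close> yields
    surjectivity, and together with injectivity it shows that \<sigma> reflects arcs.\<close>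
  have lift: "\<exists>w. (u, w) \<in> E \<and> \<sigma> w = y" if uy: "u \<in> V" "(\<sigma> u, y) \<in> E" for u y
  proof -
    obtain w where w: "w \<in> V" "s u w = y" using Aut_surj[OF s[OF uy(1)] in_arcsD2[OF uy(2)]] by blast
    then have "(u, w) \<in> E" using Aut_arc[OF s[OF uy(1)] uy(1) w(1)] uy \<sigma>_self by simp
    then show ?thesis using \<sigma>1[OF uy(1) ball_arc] w by auto
  qed
  have "y \<in> \<sigma> ` V" if "y \<in> gball v0 i" for y i
    using that
  proof (induction i arbitrary: y)
    case 0 then show ?case using v0 s0 \<sigma>_self by (force simp: ball_0)
  next
    case (Suc i)
    from ball_Suc_last[OF Suc.prems] show ?case
    proof
      assume "y = v0" then show ?thesis using v0 s0 \<sigma>_self by force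
    next
      assume "\<exists>u\<in>gball v0 i. (u, y) \<in> E"
      then obtain u where "u \<in> V" "(\<sigma> u, y) \<in> E" using Suc.IH by blast
      then show ?thesis using lift in_arcsD2 by blast
    qed
  qed
  then have "V \<subseteq> \<sigma> ` V" using in_some_ball[OF v0] by blast
  moreover have "\<sigma> ` V \<subseteq> V" using \<sigma>_self s Aut_closed by auto
  ultimately have bij: "bij_betw \<sigma> V V" using inj unfolding bij_betw_def by blast
  have arcs: "(\<sigma> u, \<sigma> v) \<in> E \<longleftrightarrow> (u, v) \<in> E" if uv: "u \<in> V" "v \<in> V" for u v
  proof
    assume "(u, v) \<in> E"
    then show "(\<sigma> u, \<sigma> v) \<in> E"
      using \<sigma>1[OF uv(1) ball_arc] \<sigma>_self[OF uv(1)] Aut_arc[OF s[OF uv(1)]] uv by simp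
  next
    assume "(\<sigma> u, \<sigma> v) \<in> E"
    then obtain w where "(u, w) \<in> E" "\<sigma> w = \<sigma> v" using lift uv(1) by blast
    then show "(u, v) \<in> E" using inj uv(2) in_arcsD2 by (metis inj_onD)
  qed
  have "\<sigma> \<in> extensional V" by (simp add: \<sigma>_def)
  then have "\<sigma> \<in> carrier A" using bij arcs by (rule Aut_memI)
  then show thesis using \<sigma> that by blast
qed

section \<open>Conjugating nearby subgroups into the closure\<close>

text \<open>A radius is chosen for each orbit, not for each vertex; with finitely many orbits the
  maximum exists.\<close>

lemma cocompact_radius:
  assumes v0: "v0 \<in> V" and H: "subgroup H A" and coc: "acts_cocompactly T H"
  obtains R where "\<And>v. v \<in> V \<Longrightarrow> \<exists>h\<in>H. h v \<in> gball v0 R"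
proof -
  interpret H: subgroup H A by fact
  let ?O = "orbits (A\<lparr>carrier := H\<rparr>) V (\<lambda>g. g)"
  have "\<forall>Z\<in>?O. \<exists>r. \<forall>v\<in>V. orbit (A\<lparr>carrier := H\<rparr>) (\<lambda>g. g) v = Z \<longrightarrow> (\<exists>h\<in>H. h v \<in> gball v0 r)"
  proof
    fix Z assume "Z \<in> ?O"
    then obtain z where z: "z \<in> V" "Z = orbit (A\<lparr>carrier := H\<rparr>) (\<lambda>g. g) z"
      unfolding orbits_def by blast
    obtain r where r: "z \<in> gball v0 r" using in_some_ball[OF v0 z(1)] by blast
    have "\<one>\<^bsub>A\<^esub> z \<in> Z" using H.one_closed unfolding z(2) orbit_def by auto
    then have zZ: "z \<in> Z" using one_apply[OF z(1)] by simp
    have "\<exists>h\<in>H. h v \<in> gball v0 r" if "orbit (A\<lparr>carrier := H\<rparr>) (\<lambda>g. g) v = Z" for v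
    proof -
      have "z \<in> {h v |h. h \<in> H}" using zZ that unfolding orbit_def by simp
      then show ?thesis using r by blast
    qed
    then show "\<exists>r. \<forall>v\<in>V. orbit (A\<lparr>carrier := H\<rparr>) (\<lambda>g. g) v = Z \<longrightarrow> (\<exists>h\<in>H. h v \<in> gball v0 r)"
      by blast
  qed
  then obtain r where r: "\<forall>Z\<in>?O. \<forall>v\<in>V. orbit (A\<lparr>carrier := H\<rparr>) (\<lambda>g. g) v = Z \<longrightarrow> (\<exists>h\<in>H. h v \<in> gball v0 (r Z))"
    by (rule bchoice[THEN exE])
  have fin: "finite (r ` ?O)" using coc unfolding acts_cocompactly_def by blast
  show thesis
  proof
    fix v assume v: "v \<in> V"
    let ?Z = "orbit (A\<lparr>carrier := H\<rparr>) (\<lambda>g. g) v"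
    have Z: "?Z \<in> ?O" using v unfolding orbits_def by blast
    then have "r ?Z \<le> Max (r ` ?O)" using fin by simp
    moreover obtain h where "h \<in> H" "h v \<in> gball v0 (r ?Z)" using r Z v by blast
    ultimately show "\<exists>h\<in>H. h v \<in> gball v0 (Max (r ` ?O))"
      using ball_mono by blast
  qed
qed

text \<open>Covering all of \<open>T\<close> by translates of a ball follows from a condition on a
  single larger ball, which is what lets it pass from \<open>H\<close> to a nearby \<open>J\<close>.
  An element bringing a neighbour of \<open>v\<close> into the ball of radius \<open>R\<close>
  brings \<open>v\<close> into that of radius \<open>Suc R\<close>, where \<open>near\<close>
  applies.\<close>

lemma covering_step:
  assumes v0: "v0 \<in> V" and J: "subgroup J A"
    and near: "\<And>v. v \<in> gball v0 (Suc R) \<Longrightarrow> \<exists>j\<in>J. j v \<in> gball v0 R"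
    and v: "v \<in> V"
  shows "\<exists>j\<in>J. j v \<in> gball v0 R"
proof -
  interpret J: subgroup J A by fact
  have "\<exists>j\<in>J. j v \<in> gball v0 R" if "v \<in> gball v0 i" for i v
    using that
  proof (induction i arbitrary: v)
    case 0 then show ?case using near[of v] ball_mono[of 0 "Suc R" v0] by auto
  next
    case (Suc i)
    from ball_Suc_last[OF Suc.prems] show ?case
    proof
      assume "v = v0" then show ?thesis using near[of v] ball_center[OF v0] by auto
    next
      assume "\<exists>u\<in>gball v0 i. (u, v) \<in> E"
      then obtain u j where u: "(u, v) \<in> E" "j \<in> J" "j u \<in> gball v0 R" using Suc.IH by blast
      have V: "u \<in> V" "v \<in> V" using in_arcsD1 in_arcsD2 u by auto
      have "(j u, j v) \<in> E" using Aut_arc u V by simp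
      then have "j v \<in> gball v0 (Suc R)" using ball_trans[OF u(3) ball_arc] by simp
      then obtain j' where "j' \<in> J" "j' (j v) \<in> gball v0 R" using near by blast
      then show ?thesis using u V by (intro bexI[of _ "j' \<otimes>\<^bsub>A\<^esub> j"]) (auto simp: mult_apply)
    qed
  qed
  then show ?thesis using in_some_ball[OF v0 v] by blast
qed

lemma displacement:
  assumes v0: "v0 \<in> V" and g: "g \<in> carrier A" and x: "x \<in> gball v0 a" and gx: "g x \<in> gball v0 b"
  shows "g v0 \<in> gball v0 (b + a)"
proof -
  have "x \<in> V" using x ball_subset by blast
  then have "g v0 \<in> gball (g x) a" using Aut_ball_image[OF g _ ball_sym[OF x]] by blast
  then show ?thesis using ball_trans[OF gx] by blast
qed

text \<open>The elements of \<open>J\<close> to be approximated carry a vertex of the ball of radius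
  \<open>Suc R\<close> into that of radius \<open>R\<close>; this bounds their displacement of
  \<open>v0\<close> by \<open>Suc (2 * R)\<close>. They are compared with \<open>H\<close> on
  \<open>k\<close>-balls around vertices of the former ball, hence the radius
  \<open>Suc R + k\<close>. Positivity of \<open>k\<close> is for the gluing.\<close>

lemma conjugate_into_closure:
  assumes v0: "v0 \<in> V" and k: "0 < k" and H: "subgroup H A" and J: "subgroup J A"
    and cover: "\<And>v. v \<in> V \<Longrightarrow> \<exists>j\<in>J. j v \<in> gball v0 R"
    and approx: "\<And>g. g \<in> J \<Longrightarrow> g v0 \<in> gball v0 (Suc (2 * R))
      \<Longrightarrow> \<exists>h\<in>H. \<forall>x\<in>gball v0 (Suc R + k). g x = h x"
  shows "\<exists>\<sigma>\<in>ball_fixator T v0 k. (\<sigma> <#\<^bsub>A\<^esub> J) #>\<^bsub>A\<^esub> (inv\<^bsub>A\<^esub> \<sigma>) \<subseteq> k_closure T k H"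
proof -
  interpret A: group A by (rule group_Aut)
  interpret H: subgroup H A by fact
  interpret J: subgroup J A by fact
  \<comment> \<open>This is admissibility at \<open>v\<close>: up to a left factor in
    \<open>H\<close>, the map is an element of \<open>J\<close> bringing \<open>v\<close> close to
    \<open>v0\<close>.\<close>
  define Q where "Q v f \<longleftrightarrow> (\<exists>h\<in>H. \<exists>j\<in>J. f = h \<otimes>\<^bsub>A\<^esub> j \<and> j v \<in> gball v0 R)" for v f
  have Q0: "Q v0 \<one>\<^bsub>A\<^esub>"
    unfolding Q_def using one_apply[OF v0] ball_center[OF v0, of R]
    by (intro bexI[of _ "\<one>\<^bsub>A\<^esub>"]) simp_all
  have step: "\<exists>f'. Q w f' \<and> (\<forall>x\<in>gball w k. f' x = f x)" if vw: "(v, w) \<in> E" and "Q v f" for v w f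
  proof -
    obtain h j where hj: "h \<in> H" "j \<in> J" "f = h \<otimes>\<^bsub>A\<^esub> j" "j v \<in> gball v0 R"
      using \<open>Q v f\<close> unfolding Q_def by blast
    have V: "v \<in> V" "w \<in> V" using in_arcsD1 in_arcsD2 vw by auto
    have "(j v, j w) \<in> E" using Aut_arc[OF J.mem_carrier[OF hj(2)] V] vw by simp
    then have jw: "j w \<in> gball v0 (Suc R)" using ball_trans[OF hj(4) ball_arc] by simp
    obtain j1 where j1: "j1 \<in> J" "j1 (j w) \<in> gball v0 R"
      using cover[OF Aut_closed[OF J.mem_carrier[OF hj(2)] V(2)]] by blast
    have "j1 v0 \<in> gball v0 (R + Suc R)"
      by (rule displacement[OF v0 J.mem_carrier[OF j1(1)] jw j1(2)])
    then have "j1 v0 \<in> gball v0 (Suc (2 * R))" by (simp add: mult_2)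
    then obtain h1 where h1: "h1 \<in> H" "\<And>x. x \<in> gball v0 (Suc R + k) \<Longrightarrow> j1 x = h1 x"
      using approx[OF j1(1)] by blast
    \<comment> \<open>The inverse of \<open>h1\<close> undoes \<open>j1\<close> on the image of the
      \<open>k\<close>-ball around \<open>w\<close> under \<open>j\<close>, so the map is unchanged
      there while its \<open>J\<close>-part now brings \<open>w\<close> close to
      \<open>v0\<close>.\<close>
    let ?f = "(h \<otimes>\<^bsub>A\<^esub> inv\<^bsub>A\<^esub> h1) \<otimes>\<^bsub>A\<^esub> (j1 \<otimes>\<^bsub>A\<^esub> j)"
    have "h \<otimes>\<^bsub>A\<^esub> inv\<^bsub>A\<^esub> h1 \<in> H" "j1 \<otimes>\<^bsub>A\<^esub> j \<in> J" using hj h1 j1 by simp_all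
    moreover have "(j1 \<otimes>\<^bsub>A\<^esub> j) w \<in> gball v0 R" using hj j1 V by (simp add: mult_apply)
    ultimately have "Q w ?f" unfolding Q_def by blast
    moreover have "?f x = f x" if x: "x \<in> gball w k" for x
    proof -
      have xV: "x \<in> V" using x ball_subset by blast
      then have jxV: "j x \<in> V" using Aut_closed hj by simp
      have "j x \<in> gball v0 (Suc R + k)"
        by (rule ball_trans[OF jw Aut_ball_image[OF J.mem_carrier[OF hj(2)] V(2) x]])
      then have "j1 (j x) = h1 (j x)" by (rule h1(2))
      moreover have "h1 (j x) \<in> V" using h1(1) jxV Aut_closed by simp
      ultimately have "?f x = h ((inv\<^bsub>A\<^esub> h1) (h1 (j x)))"
        using hj(1,2) h1(1) j1(1) xV jxV by (simp add: mult_apply)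
      then show ?thesis using hj(1-3) h1(1) xV jxV by (simp add: inv_apply_left mult_apply)
    qed
    ultimately show ?thesis by blast
  qed
  obtain s where s: "s v0 = \<one>\<^bsub>A\<^esub>" "\<And>v. v \<in> V \<Longrightarrow> Q v (s v)"
    "\<And>v w. (v, w) \<in> E \<Longrightarrow> (\<forall>x\<in>gball w k. s w x = s v x) \<or> (\<forall>x\<in>gball v k. s v x = s w x)"
  proof (rule choice_along_tree[of v0 Q "\<one>\<^bsub>A\<^esub>" "\<lambda>v w f f'. \<forall>x\<in>gball w k. f' x = f x", OF v0 Q0 step])
    fix t assume "t v0 = \<one>\<^bsub>A\<^esub>" "\<And>v. v \<in> V \<Longrightarrow> Q v (t v)"
      "\<And>v w. (v, w) \<in> E \<Longrightarrow> (\<forall>x\<in>gball w k. t w x = t v x) \<or> (\<forall>x\<in>gball v k. t v x = t w x)"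
    then show thesis by (rule that[of t])
  qed
  obtain \<sigma> where \<sigma>: "\<sigma> \<in> carrier A" "\<And>v x. v \<in> V \<Longrightarrow> x \<in> gball v k \<Longrightarrow> \<sigma> x = s v x"
  proof (rule glue_automorphisms[OF v0 k])
    show "s v \<in> carrier A" if "v \<in> V" for v using s(2)[OF that] unfolding Q_def by force
    show "s v0 v0 = v0" using s(1) v0 one_apply by simp
    show "s v x = s w x" if "(v, w) \<in> E" "x \<in> gball v k" "x \<in> gball w k" for v w x
      using s(3)[OF that(1)] that(2,3) by metis
  qed blast
  have "\<sigma> \<in> ball_fixator T v0 k"
    using \<sigma>(1) \<sigma>(2)[OF v0] s(1) one_apply subsetD[OF ball_subset] by (simp add: ball_fixator_def)
  moreover have "\<sigma> \<otimes>\<^bsub>A\<^esub> g \<otimes>\<^bsub>A\<^esub> inv\<^bsub>A\<^esub> \<sigma> \<in> k_closure T k H" if g: "g \<in> J" for g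
  proof -
    have gA: "g \<in> carrier A" using g by simp
    have "\<exists>h\<in>H. \<forall>y\<in>gball x k. (\<sigma> \<otimes>\<^bsub>A\<^esub> g \<otimes>\<^bsub>A\<^esub> inv\<^bsub>A\<^esub> \<sigma>) y = h y" if x: "x \<in> V" for x
    proof -
      obtain v where v: "v \<in> V" "\<sigma> v = x" using Aut_surj[OF \<sigma>(1) x] by blast
      have gv: "g v \<in> V" using Aut_closed[OF gA v(1)] .
      obtain h j where hj: "h \<in> H" "j \<in> J" "s v = h \<otimes>\<^bsub>A\<^esub> j" "j v \<in> gball v0 R"
        using s(2)[OF v(1)] unfolding Q_def by blast
      obtain h' j' where hj': "h' \<in> H" "j' \<in> J" "s (g v) = h' \<otimes>\<^bsub>A\<^esub> j'" "j' (g v) \<in> gball v0 R"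
        using s(2)[OF gv] unfolding Q_def by blast
      \<comment> \<open>On the \<open>k\<close>-ball around \<open>x\<close>, the conjugate of
        \<open>g\<close> by \<sigma> is \<open>?q\<close> multiplied by \<open>h'\<close> on the
        left and by the inverse of \<open>h\<close> on the right. Since \<open>?q\<close> maps
        \<open>j v\<close> to \<open>j' (g v)\<close>, both within \<open>R\<close> of
        \<open>v0\<close>, its displacement is at most \<open>R + R\<close> and it can be replaced
        by an element of \<open>H\<close>.\<close>
      let ?q = "j' \<otimes>\<^bsub>A\<^esub> g \<otimes>\<^bsub>A\<^esub> inv\<^bsub>A\<^esub> j"
      have qJ: "?q \<in> J" using hj hj' g by simp
      have q: "?q (j z) = j' (g z)" if "z \<in> V" for z
      proof -
        have "(inv\<^bsub>A\<^esub> j) (j z) = z" "j z \<in> V"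
          using inv_apply_left that hj(2) Aut_closed by simp_all
        then show ?thesis using that hj(2) hj'(2) gA by (simp add: mult_apply)
      qed
      have "?q v0 \<in> gball v0 (R + R)"
        using displacement[OF v0 J.mem_carrier[OF qJ] hj(4), of R] q[OF v(1)] hj'(4) by simp
      then have "?q v0 \<in> gball v0 (Suc (2 * R))"
        using ball_mono[of "R + R" "Suc (2 * R)" v0] by auto
      then obtain h1 where h1: "h1 \<in> H" "\<And>y. y \<in> gball v0 (Suc R + k) \<Longrightarrow> ?q y = h1 y"
        using approx[OF qJ] by blast
      show ?thesis
      proof (intro bexI ballI)
        show "h' \<otimes>\<^bsub>A\<^esub> h1 \<otimes>\<^bsub>A\<^esub> inv\<^bsub>A\<^esub> h \<in> H" using hj hj' h1 by simp
        fix y assume y: "y \<in> gball x k"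
        have yV: "y \<in> V" using y ball_subset by blast
        obtain z where z: "z \<in> V" "\<sigma> z = y" using Aut_surj[OF \<sigma>(1) yV] by blast
        have zv: "z \<in> gball v k" using Aut_ball_iff[OF \<sigma>(1) v(1) z(1)] y v(2) z(2) by simp
        have gz: "g z \<in> gball (g v) k" by (rule Aut_ball_image[OF gA v(1) zv])
        have gzV: "g z \<in> V" by (rule Aut_closed[OF gA z(1)])
        have jz: "j z \<in> V" "j z \<in> gball v0 (Suc R + k)"
        proof -
          show "j z \<in> V" by (rule Aut_closed[OF J.mem_carrier[OF hj(2)] z(1)])
          have "j z \<in> gball v0 (R + k)"
            by (rule ball_trans[OF hj(4) Aut_ball_image[OF J.mem_carrier[OF hj(2)] v(1) zv]])
          then show "j z \<in> gball v0 (Suc R + k)" using ball_mono[of "R + k" "Suc R + k" v0] by auto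
        qed
        have y_eq: "y = h (j z)" using \<sigma>(2)[OF v(1) zv] hj(1-3) z by (simp add: mult_apply)
        have "(\<sigma> \<otimes>\<^bsub>A\<^esub> g \<otimes>\<^bsub>A\<^esub> inv\<^bsub>A\<^esub> \<sigma>) y = \<sigma> (g ((inv\<^bsub>A\<^esub> \<sigma>) (\<sigma> z)))"
          using \<sigma>(1) gA yV z(2) Aut_closed[of "inv\<^bsub>A\<^esub> \<sigma>" y] by (simp add: mult_apply)
        also have "\<dots> = h' (j' (g z))"
          using inv_apply_left[OF \<sigma>(1) z(1)] \<sigma>(2)[OF gv gz] hj'(1-3) gzV by (simp add: mult_apply)
        also have "\<dots> = h' (h1 (j z))" using q[OF z(1)] h1(2)[OF jz(2)] by simp
        also have "\<dots> = (h' \<otimes>\<^bsub>A\<^esub> h1 \<otimes>\<^bsub>A\<^esub> inv\<^bsub>A\<^esub> h) y"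
        proof -
          have "(inv\<^bsub>A\<^esub> h) y = j z"
            unfolding y_eq by (rule inv_apply_left[OF H.mem_carrier[OF hj(1)] jz(1)])
          then show ?thesis using hj(1) hj'(1) h1(1) jz(1) yV by (simp add: mult_apply)
        qed
        finally show "(\<sigma> \<otimes>\<^bsub>A\<^esub> g \<otimes>\<^bsub>A\<^esub> inv\<^bsub>A\<^esub> \<sigma>) y = (h' \<otimes>\<^bsub>A\<^esub> h1 \<otimes>\<^bsub>A\<^esub> inv\<^bsub>A\<^esub> h) y" .
      qed
    qed
    then show ?thesis using \<sigma>(1) gA unfolding k_closure_def by simp
  qed
  ultimately show ?thesis
    by (intro bexI[of _ \<sigma>]) (auto simp: l_coset_def r_coset_def)
qed

lemma ball_fixator_antimono: "i \<le> k \<Longrightarrow> ball_fixator T v k \<subseteq> ball_fixator T v i"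
  using ball_mono[of i k v] unfolding ball_fixator_def by blast

lemma k_closure_antimono: "i \<le> k \<Longrightarrow> k_closure T k H \<subseteq> k_closure T i H"
  unfolding k_closure_def using ball_mono[of i k] by (smt (verit) mem_Collect_eq subset_iff)

text \<open>The fixator stands on the right and acts first, so agreement holds on the ball around
  \<open>v0\<close> itself, not on its image.\<close>

lemma coset_ball_fixator:
  assumes v0: "v0 \<in> V" and H: "H \<subseteq> carrier A" and g: "g \<in> H <#>\<^bsub>A\<^esub> ball_fixator T v0 n"
  shows "\<exists>h\<in>H. \<forall>x\<in>gball v0 n. g x = h x"
proof -
  obtain h u where hu: "h \<in> H" "u \<in> ball_fixator T v0 n" "g = h \<otimes>\<^bsub>A\<^esub> u"
    using g unfolding set_mult_def by blast
  then have hA: "h \<in> carrier A" and u: "u \<in> carrier A" "\<And>x. x \<in> gball v0 n \<Longrightarrow> u x = x"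
    using H by (auto simp: ball_fixator_def)
  have "g x = h x" if x: "x \<in> gball v0 n" for x
    using mult_apply[OF hA u(1), of x] u(2)[OF x] subsetD[OF ball_subset x] hu(3) by simp
  then show ?thesis using hu by blast
qed

end

section \<open>A neighbourhood of \<open>H\<close> determined by its action on one finite
  ball\<close>

theorem corollary5p6:
  fixes T :: "'v pair_pre_digraph" and H :: "('v \<Rightarrow> 'v) set" and v0 :: 'v and k :: nat
  assumes "undirected_tree T" and "locally_finite_graph T"
    and "H \<in> closed_subgroups (Aut T) (Aut_top T)"
    and "unimodular (Aut T \<lparr>carrier := H\<rparr>) (subtopology (Aut_top T) H)"
    and "acts_cocompactly T H"
    and "v0 \<in> pverts T"
  shows "\<exists>W. openin (chabauty (Aut T) (Aut_top T)) W \<and> H \<in> W \<and>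
    W \<subseteq> {J \<in> closed_subgroups (Aut T) (Aut_top T).
      \<exists>\<sigma> \<in> ball_fixator T v0 k.
        (\<sigma> <#\<^bsub>Aut T\<^esub> J) #>\<^bsub>Aut T\<^esub> (inv\<^bsub>Aut T\<^esub> \<sigma>) \<subseteq> k_closure T k H}"
proof -
  interpret lf_tree T using assms(1,2) by unfold_locales
  interpret A: group A by (rule group_Aut)
  note v0 = assms(6)
  have H: "subgroup H A" using assms(3) unfolding closed_subgroups_def by blast
  then have HA: "H \<subseteq> carrier A" by (rule subgroup.subset)
  obtain R where R: "\<And>v. v \<in> V \<Longrightarrow> \<exists>h\<in>H. h v \<in> gball v0 R"
    using cocompact_radius[OF v0 H assms(5)] by blast
  \<comment> \<open>The argument is run with \<open>Suc k\<close> in place of \<open>k\<close>,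
    because the gluing needs a positive radius while \<open>k\<close> may be zero. The radius also
    covers the ball of radius \<open>Suc R\<close> used for the covering.\<close>
  define n where "n = Suc R + Suc k"
  \<comment> \<open>This contains every automorphism carrying a vertex of the ball of radius
    \<open>Suc R\<close> into that of radius \<open>R\<close>.\<close>
  define K where "K = {g \<in> carrier A. g v0 \<in> gball v0 (Suc (2 * R))}"
  define U where "U = ball_fixator T v0 n"
  define W where "W = chabauty_nbhd A X H K U"
  have U: "subgroup U A" unfolding U_def by (rule subgroup_ball_fixator[OF v0])
  have "openin (chabauty A X) W"
    unfolding W_def
  proof (rule openin_chabauty_nbhd[OF group_Aut HA])
    show "compactin X K" unfolding K_def by (rule compactin_Aut[OF v0])
    show "openin X U" unfolding U_def by (rule openin_ball_fixator[OF v0])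
    \<comment> \<open>Elements of \<open>U\<close> fix \<open>v0\<close>, so right multiplication by
      them does not change \<open>g v0\<close>.\<close>
    show "g \<otimes>\<^bsub>A\<^esub> u \<in> K" if "g \<in> K" "u \<in> U" for g u
      using that ball_center[OF v0, of n] v0 by (simp add: K_def U_def ball_fixator_def mult_apply)
  qed fact
  moreover have "H \<in> W"
  proof -
    have "h \<in> H <#>\<^bsub>A\<^esub> U" if "h \<in> H" for h
    proof -
      have "h = h \<otimes>\<^bsub>A\<^esub> \<one>\<^bsub>A\<^esub>" using that HA by (simp add: subsetD)
      then show ?thesis
        using that subgroup.one_closed[OF U] unfolding set_mult_def by blast
    qed
    then show ?thesis using assms(3) unfolding W_def chabauty_nbhd_def by blast
  qed
  moreover have "\<exists>\<sigma>\<in>ball_fixator T v0 k. (\<sigma> <#\<^bsub>A\<^esub> J) #>\<^bsub>A\<^esub> (inv\<^bsub>A\<^esub> \<sigma>) \<subseteq> k_closure T k H"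
    if "J \<in> W" for J
  proof -
    have JHU: "J \<inter> K \<subseteq> H <#>\<^bsub>A\<^esub> U" and HJU: "H \<inter> K \<subseteq> J <#>\<^bsub>A\<^esub> U" and J: "subgroup J A"
      using that unfolding W_def chabauty_nbhd_def closed_subgroups_def by auto
    have JA: "J \<subseteq> carrier A" using J by (rule subgroup.subset)
    \<comment> \<open>An element of \<open>H\<close> bringing \<open>w\<close> into the ball of
      radius \<open>R\<close> lies in \<open>K\<close>, hence agrees on the ball of radius
      \<open>n\<close> with an element of \<open>J\<close>. The latter therefore moves
      \<open>w\<close> in the same way.\<close>
    have cover: "\<exists>j\<in>J. j v \<in> gball v0 R" if "v \<in> V" for v
    proof (rule covering_step[OF v0 J _ that])
      fix w assume w: "w \<in> gball v0 (Suc R)"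
      then have wV: "w \<in> V" using ball_subset by blast
      then obtain h where h: "h \<in> H" "h w \<in> gball v0 R" using R by blast
      have hA: "h \<in> carrier A" using h(1) HA by blast
      have "h v0 \<in> gball v0 (R + Suc R)"
        by (rule displacement[where g = h, OF v0 hA w h(2)])
      then have "h \<in> K" using hA by (simp add: K_def mult_2)
      then obtain j where "j \<in> J" "\<forall>x\<in>gball v0 n. h x = j x"
        using coset_ball_fixator[OF v0 JA, of h n] HJU h(1) unfolding U_def by blast
      moreover have "w \<in> gball v0 n" using w ball_mono[of "Suc R" n v0] by (auto simp: n_def)
      ultimately show "\<exists>j\<in>J. j w \<in> gball v0 R" using h(2) by metis
    qed
    have "\<exists>h\<in>H. \<forall>x\<in>gball v0 (Suc R + Suc k). g x = h x"
      if "g \<in> J" "g v0 \<in> gball v0 (Suc (2 * R))" for g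
    proof -
      have "g \<in> J \<inter> K" using that JA unfolding K_def by blast
      then have "g \<in> H <#>\<^bsub>A\<^esub> ball_fixator T v0 (Suc R + Suc k)"
        using JHU unfolding U_def n_def by blast
      then show ?thesis by (rule coset_ball_fixator[OF v0 HA])
    qed
    from conjugate_into_closure[OF v0 zero_less_Suc H J cover this]
    obtain \<sigma> where \<sigma>: "\<sigma> \<in> ball_fixator T v0 (Suc k)"
      "(\<sigma> <#\<^bsub>A\<^esub> J) #>\<^bsub>A\<^esub> (inv\<^bsub>A\<^esub> \<sigma>) \<subseteq> k_closure T (Suc k) H" by blast
    \<comment> \<open>Both the fixator and the closure shrink as the radius grows, so the conclusion
      for \<open>Suc k\<close> gives the one for \<open>k\<close>.\<close>
    show ?thesis
    proof
      show "\<sigma> \<in> ball_fixator T v0 k"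
        using \<sigma>(1) ball_fixator_antimono[of k "Suc k" v0] by auto
      show "(\<sigma> <#\<^bsub>A\<^esub> J) #>\<^bsub>A\<^esub> (inv\<^bsub>A\<^esub> \<sigma>) \<subseteq> k_closure T k H"
        using \<sigma>(2) k_closure_antimono[of k "Suc k" H] by (meson lessI less_imp_le order_trans)
    qed
  qed
  moreover have "W \<subseteq> closed_subgroups A X"
    unfolding W_def chabauty_nbhd_def by (rule Collect_restrict)
  ultimately show ?thesis by blast
qed

end
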